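(* Let $d\ge2$, $L>0$, $\Omega_L=(0,2\pi L)^{d-1}\times\mathbb{R}$, and let $\omega\subset\Omega_L$ be a measurable set with $|\omega|>0$. Then $\omega$ is not thick with respect to $\Omega_L$ if and only if there exist a sequence of points $(y_n)_{n\in\mathbb{N}}$ in $\Omega_L$, a time $T>0$ and a constant $\kappa>1$ such that $$-2T\log\left(\int_\omega\exp\left(-\frac{\|x-y_n\|_2^2}{2T}\right)dx\right)-\kappa\,\frac{\pi^2d^2}{4}\left(\frac{T}{d_b(y_n,\partial\Omega_L)}\right)^2\longrightarrow+\infty\quad\text{as } n\to\infty,$$ where $d_b(y_n,\partial\Omega_L)=\min\left(\operatorname{dist}(y_n,\partial\Omega_L),\frac{T\pi^2d}{4}\right)$.
   Context: $|\cdot|$ is Lebesgue measure, $\|\cdot\|_2$ the Euclidean norm, and $\operatorname{dist}$ the Euclidean distance. Thickness with respect to $\Omega_L$: a measurable set $S\subset\Omega_L$ of positive measure is thick with respect to $\Omega_L$ if there exist $\gamma\in(0,1]$ and $a=(a_1,\dots,a_d)$ with all $a_j>0$ and $a_j\le2\pi L$ for $j=1,\dots,d-1$, such that $|S\cap P|\ge\gamma|P|$ for every hyperrectangle $P\subset\Omega_L$ with sides parallel to the coordinate axes and of lengths $a_1,\dots,a_d$ (hyperrectangles are open, i.e. translates of $(0,a_1)\times\dots\times(0,a_d)$). *)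

theory Defs
  imports "HOL-Analysis.Analysis"
begin

text \<open>
  Points of \<open>\<real>\<^sup>d\<close> are split as the first \<open>d - 1\<close> coordinates, indexed by the finite type
  \<open>'m\<close>, and the last coordinate. Index types are nonempty, so \<open>d = CARD('m) + 1\<close> ranges
  over exactly the dimensions \<open>d \<ge> 2\<close>. The product norm is the Euclidean one.
\<close>

type_synonym 'm point = "(real ^ 'm) \<times> real"

lemma DIM_point: "DIM('m::finite point) = CARD('m) + 1"
  by simp

lemma DIM_point_ge_2: "DIM('m::finite point) \<ge> 2"
  by (simp add: Suc_le_eq)

definition Omega :: "real \<Rightarrow> ('m::finite point) set" where
  "Omega L = {x. \<forall>j. 0 < x $ j \<and> x $ j < 2 * pi * L} \<times> UNIV"

text \<open>
  In thickness, \<open>box c (c + a)\<close> is the open hyperrectangle with corner \<open>c\<close> and side lengths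
  given by the coordinates of \<open>a\<close>. It has finite measure, so the real-valued \<open>measure\<close> is
  adequate there, whereas \<open>S\<close> itself may have infinite measure.
\<close>

definition thick :: "real \<Rightarrow> ('m::finite point) set \<Rightarrow> bool" where
  "thick L S \<longleftrightarrow>
     S \<in> sets lebesgue \<and> S \<subseteq> Omega L \<and> emeasure lebesgue S > 0 \<and>
     (\<exists>\<gamma>::real. \<exists>a::'m point.
        0 < \<gamma> \<and> \<gamma> \<le> 1 \<and>
        (\<forall>j. 0 < fst a $ j \<and> fst a $ j \<le> 2 * pi * L) \<and> 0 < snd a \<and>
        (\<forall>c. box c (c + a) \<subseteq> Omega L \<longrightarrow>
           measure lebesgue (S \<inter> box c (c + a)) \<ge> \<gamma> * measure lebesgue (box c (c + a))))"

definition bdist :: "real \<Rightarrow> real \<Rightarrow> 'm::finite point \<Rightarrow> real" where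
  "bdist L T y = min (infdist y (frontier (Omega L))) (T * pi\<^sup>2 * real DIM('m point) / 4)"

end

theory Submission
  imports Defs "HOL-Probability.Distributions"
begin

text \<open>
  The logarithmic term tends to infinity exactly when the Gaussian integral centred at \<open>y n\<close> tends
  to \<open>0\<close>, and this integral is governed by the mass of \<open>\<omega>\<close> in boxes near \<open>y n\<close>.

  Suppose \<open>\<omega>\<close> is thick with parameters \<open>\<gamma>\<close> and \<open>a\<close>. Each point \<open>y\<close> of the slab is adherent to a box
  of side lengths \<open>a\<close> inside the slab, the Gaussian is at least \<open>exp (- (norm a)\<^sup>2 / (2 * T))\<close> on that
  box, and \<open>\<omega>\<close> fills a proportion \<open>\<gamma>\<close> of it. Hence the integral is bounded below uniformly in \<open>y\<close>
  (\<open>thick_imp_gaussian_integral_bounded_below\<close>). The boundary term is only subtracted, so the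
  functional is bounded above and no sequence of points makes it diverge.

  Suppose \<open>\<omega>\<close> is not thick. Apply the failure of thickness to boxes that fill the whole
  cross-section and are very long in the last coordinate, with a proportion so small that
  even the absolute mass of \<open>\<omega>\<close> in the box is small, although the boxes grow
  (\<open>not_thick_imp_long_sparse_box\<close>). Let \<open>y n\<close> be the centres of such boxes. Inside the box the
  integral is at most the mass of \<open>\<omega>\<close>; outside, it is at most the tail of a one-dimensional
  Gaussian times the volume of the cross-section. So the integrals tend to \<open>0\<close>. Since the boxes are
  of full width, their centres lie on the axis of the slab, at distance \<open>pi * L\<close> from the boundary:
  the boundary term stays bounded and cannot compensate the divergence, whatever \<open>T\<close> and \<open>\<kappa>\<close> are.
\<close>

section \<open>Geometry of the slab\<close>

lemma Omega_eq_Times: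
  "Omega L = box (0 :: real ^ 'm::finite) (\<chi> j. 2 * pi * L) \<times> (UNIV :: real set)"
  by (auto simp: Omega_def mem_box_cart)

lemma open_Omega: "open (Omega L :: 'm::finite point set)"
  unfolding Omega_eq_Times by (intro open_Times open_box open_UNIV)

lemma inner_Basis_pos_point:
  fixes a :: "'m::finite point"
  assumes "\<forall>j. 0 < fst a $ j" "0 < snd a" "b \<in> Basis"
  shows "0 < a \<bullet> b"
  using assms by (auto simp: Basis_prod_def inner_prod_def Basis_vec_def inner_axis)

lemma measure_lebesgue_box_add:
  fixes a c :: "'a::euclidean_space"
  assumes "\<And>b. b \<in> Basis \<Longrightarrow> 0 < a \<bullet> b"
  shows "measure lebesgue (box c (c + a)) = (\<Prod>b\<in>Basis. a \<bullet> b)"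
  using assms by (simp add: measure_completion inner_add_left less_imp_le)

lemma lmeasurable_Int_box:
  fixes \<omega> :: "'a::euclidean_space set"
  assumes "\<omega> \<in> sets lebesgue"
  shows "\<omega> \<inter> box a b \<in> lmeasurable"
  using fmeasurable_Int_fmeasurable[OF lmeasurable_box assms] by (simp add: Int_commute)

text \<open>
  The bound \<open>2 * pi * L\<close> on the lateral sides is what lets a box of the prescribed shape reach
  every point of the slab. Adherence to the box suffices, because it already bounds the distance
  from \<open>y\<close> to the points of the box by \<open>norm a\<close>.
\<close>

lemma closed_box_at_point_of_Omega:
  fixes y a :: "'m::finite point"
  assumes y: "y \<in> Omega L"
    and a: "\<forall>j. 0 < fst a $ j \<and> fst a $ j \<le> 2 * pi * L" "0 < snd a"
  obtains c where "box c (c + a) \<subseteq> Omega L" "y \<in> cbox c (c + a)"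
proof
  \<comment> \<open>start the box at \<open>y\<close>, and push it back wherever it would cross an upper face\<close>
  let ?c = "((\<chi> j. min (fst y $ j) (2 * pi * L - fst a $ j)), snd y) :: 'm point"
  have y': "0 < fst y $ j" "fst y $ j < 2 * pi * L" for j
    using y by (auto simp: Omega_def)
  show "box ?c (?c + a) \<subseteq> Omega L"
  proof
    fix x assume "x \<in> box ?c (?c + a)"
    then have x: "min (fst y $ j) (2 * pi * L - fst a $ j) < fst x $ j"
      "fst x $ j < min (fst y $ j) (2 * pi * L - fst a $ j) + fst a $ j" for j
      by (auto simp: box_prod mem_box_cart)
    have "0 < fst x $ j \<and> fst x $ j < 2 * pi * L" for j
      using x[of j] y'[of j] a(1)[rule_format, of j] by (auto simp: min_def split: if_splits)
    then show "x \<in> Omega L"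
      by (cases x) (simp add: Omega_def)
  qed
  show "y \<in> cbox ?c (?c + a)"
    using y' a by (cases y) (fastforce simp: cbox_prod mem_box_cart min_def less_imp_le)
qed

text \<open>
  A box of full width has no lateral freedom. This is what keeps the centres of the sparse boxes
  away from the boundary.
\<close>

lemma fst_corner_of_full_width_box:
  fixes c :: "'m::finite point"
  assumes sub: "box c (c + ((\<chi> j. 2 * pi * L), h)) \<subseteq> Omega L" and "0 < L" "0 < h"
  shows "fst c = 0"
proof -
  let ?a = "(\<chi> j. 2 * pi * L) :: real ^ 'm"
  have "box (snd c) (snd c + h) \<noteq> {}"
    using \<open>0 < h\<close> by simp
  then have "box (fst c) (fst c + ?a) \<subseteq> box 0 ?a"
    using sub unfolding box_prod[of c] Omega_eq_Times by (auto simp: times_subset_iff)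
  then have le: "0 \<le> fst c $ j \<and> fst c $ j + 2 * pi * L \<le> 2 * pi * L" for j
    using \<open>0 < L\<close> by (simp add: subset_interval_cart)
  have "fst c $ j = 0" for j
    using le[of j] by linarith
  then show ?thesis
    by (simp add: vec_eq_iff)
qed

lemma infdist_axis_frontier_Omega:
  fixes y :: "'m::finite point"
  assumes "0 < L" and y: "fst y = (\<chi> j. pi * L)"
  shows "pi * L \<le> infdist y (frontier (Omega L))"
proof -
  have ball: "ball y (pi * L) \<subseteq> Omega L"
  proof
    fix x assume x: "x \<in> ball y (pi * L)"
    have "0 < fst x $ j \<and> fst x $ j < 2 * pi * L" for j
    proof -
      have "\<bar>fst x $ j - pi * L\<bar> \<le> norm (fst (x - y))"
        using component_le_norm_cart[of "fst (x - y)" j] y by simp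
      also have "\<dots> \<le> norm (x - y)"
        by (metis norm_fst_le prod.collapse)
      also have "\<dots> < pi * L"
        using x by (simp add: dist_norm norm_minus_commute)
      finally show ?thesis by (simp add: abs_less_iff algebra_simps)
    qed
    then show "x \<in> Omega L"
      by (cases x) (simp add: Omega_def)
  qed
  have in_Omega: "y \<in> Omega L"
    using ball \<open>0 < L\<close> by (simp add: subset_eq)
  have "((\<chi> j. - 1), 0) \<notin> (Omega L :: 'm point set)"
    by (auto simp: Omega_def)
  \<comment> \<open>the frontier must be shown nonempty, because \<open>infdist\<close> to the empty set is \<open>0\<close>\<close>
  then have ne: "frontier (Omega L :: 'm point set) \<noteq> {}"
    using in_Omega by (auto simp: frontier_eq_empty)
  have "frontier (Omega L) \<inter> (Omega L :: 'm point set) = {}"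
    using open_Omega frontier_disjoint_eq by blast
  then have "\<And>x. x \<in> frontier (Omega L) \<Longrightarrow> pi * L \<le> dist y x"
    using ball by (meson disjoint_iff mem_ball not_le subsetD)
  then show ?thesis
    using ne by (simp add: infdist_def cINF_greatest)
qed

section \<open>Gaussian integrals over subsets of the slab\<close>

text \<open>
  The cross-section of the slab is bounded, so Gaussian decay in the last coordinate alone gives
  integrability over the slab. This turns all the estimates below into one-dimensional ones.
\<close>

lemma integrable_axial_gaussian:
  fixes s T :: real
  assumes "0 < T"
  shows "integrable lborel
    (\<lambda>x::'m::finite point. indicator (Omega L) x * exp (- ((snd x - s)\<^sup>2 / (2 * T))))"
proof -
  let ?B = "box 0 (\<chi> j. 2 * pi * L) :: (real ^ 'm) set"
  let ?g = "\<lambda>t. exp (- ((t - s)\<^sup>2 / (2 * T)))"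
  have "?g = (\<lambda>t. sqrt (2 * pi * T) * normal_density s (sqrt T) t)"
    using assms by (auto simp: normal_density_def fun_eq_iff)
  moreover have "integrable lborel (\<lambda>t. sqrt (2 * pi * T) * normal_density s (sqrt T) t)"
    using assms by (intro integrable_mult_right integrable_normal_density) auto
  ultimately have g: "integrable lborel ?g"
    by simp
  have "integrable (lborel \<Otimes>\<^sub>M lborel) (\<lambda>x. indicator ?B (fst x) * ?g (snd x))"
  proof (rule lborel_pair.Fubini_integrable)
    show "(\<lambda>x. indicator ?B (fst x) * ?g (snd x)) \<in> borel_measurable (lborel \<Otimes>\<^sub>M lborel)"
      by measurable
    have "emeasure lborel ?B < \<infinity>"
      by (simp add: emeasure_lborel_box_eq)
    then have "integrable lborel (indicator ?B :: _ \<Rightarrow> real)"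
      by (intro integrable_real_indicator) auto
    then show "integrable lborel
        (\<lambda>x. LINT y|lborel. norm (indicator ?B (fst (x, y)) * ?g (snd (x, y))))"
      by (simp add: abs_mult)
    show "AE x in lborel. integrable lborel (\<lambda>y. indicator ?B (fst (x, y)) * ?g (snd (x, y)))"
      using g by simp
  qed
  moreover have "(\<lambda>x. indicator ?B (fst x) * ?g (snd x)) =
      (\<lambda>x. indicator (Omega L) x * ?g (snd x))"
    by (auto simp: Omega_eq_Times indicator_def)
  ultimately show ?thesis
    by (simp add: lborel_prod)
qed

lemma borel_measurable_axial_tail:
  "(\<lambda>x::'m::finite point. indicator (Omega L \<inter> {x. r \<le> \<bar>snd x - s\<bar>}) x
      * exp (- ((snd x - s)\<^sup>2 / (2 * T)))) \<in> borel_measurable borel"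
proof -
  have "closed {x::'m point. r \<le> \<bar>snd x - s\<bar>}"
    by (intro closed_Collect_le continuous_intros)
  then have [measurable]: "Omega L \<inter> {x::'m point. r \<le> \<bar>snd x - s\<bar>} \<in> sets borel"
    by (intro sets.Int borel_open[OF open_Omega] borel_closed)
  have [measurable]: "(snd :: 'm point \<Rightarrow> real) \<in> borel_measurable borel"
    by (intro borel_measurable_continuous_onI continuous_intros)
  show ?thesis
    by measurable
qed

text \<open>
  The slab is invariant under translations of the last coordinate, so the tail does not depend on
  the centres \<open>s n\<close>, which may run off to infinity, but only on the radii \<open>r n\<close>.
\<close>

lemma axial_tail_integral_tendsto_0:
  fixes s :: "nat \<Rightarrow> real"
  assumes "0 < T" and r: "filterlim r at_top sequentially"
  shows "(\<lambda>n. LINT x::'m::finite point|lborel.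
      indicator (Omega L \<inter> {x. r n \<le> \<bar>snd x - s n\<bar>}) x * exp (- ((snd x - s n)\<^sup>2 / (2 * T))))
    \<longlonglongrightarrow> 0"
proof -
  let ?f = "\<lambda>s r (x::'m point).
      indicator (Omega L \<inter> {x. r \<le> \<bar>snd x - s\<bar>}) x * exp (- ((snd x - s)\<^sup>2 / (2 * T)))"
  have meas: "?f s r \<in> borel_measurable borel" for s r :: real
    by (rule borel_measurable_axial_tail)
  have shift: "integral\<^sup>L lborel (?f s r) = integral\<^sup>L lborel (?f 0 r)" for s r :: real
  proof -
    have "integral\<^sup>L lborel (?f s r) =
        integral\<^sup>L (distr lborel borel ((+) (0, s))) (?f s r)"
      by (simp add: lborel_distr_plus)
    also have "\<dots> = (LINT x|lborel. ?f s r ((0, s) + x))"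
      using meas by (intro integral_distr) auto
    also have "\<dots> = integral\<^sup>L lborel (?f 0 r)"
      by (intro Bochner_Integration.integral_cong)
        (auto simp: indicator_def Omega_def)
    finally show ?thesis .
  qed
  have "(\<lambda>n. integral\<^sup>L lborel (?f 0 (r n))) \<longlonglongrightarrow> integral\<^sup>L lborel (\<lambda>x::'m point. 0)"
  proof (rule integral_dominated_convergence)
    show "integrable lborel
        (\<lambda>x::'m point. indicator (Omega L) x * exp (- ((snd x - 0)\<^sup>2 / (2 * T))))"
      using assms(1) by (rule integrable_axial_gaussian)
    show "AE x in lborel. (\<lambda>n. ?f 0 (r n) x) \<longlonglongrightarrow> 0"
    proof (rule AE_I2)
      fix x :: "'m point"
      have "eventually (\<lambda>n. \<bar>snd x\<bar> < r n) sequentially"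
        using r by (simp add: filterlim_at_top_dense)
      then have "eventually (\<lambda>n. ?f 0 (r n) x = 0) sequentially"
        by eventually_elim auto
      then show "(\<lambda>n. ?f 0 (r n) x) \<longlonglongrightarrow> 0"
        by (rule tendsto_eventually)
    qed
    show "\<And>n. AE x in lborel. norm (?f 0 (r n) x)
        \<le> indicator (Omega L) x * exp (- ((snd x - 0)\<^sup>2 / (2 * T)))"
      by (auto simp: indicator_def)
    show "\<And>n. ?f 0 (r n) \<in> borel_measurable lborel"
      unfolding measurable_lborel2 using meas by blast
  qed auto
  then show ?thesis
    by (simp add: shift)
qed

lemma exp_norm_le_exp_snd:
  fixes x y :: "'m::finite point"
  assumes "0 < T"
  shows "exp (- ((norm (x - y))\<^sup>2 / (2 * T))) \<le> exp (- ((snd x - snd y)\<^sup>2 / (2 * T)))"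
proof -
  have "\<bar>snd x - snd y\<bar> \<le> norm (x - y)"
    by (metis norm_snd_le prod.collapse real_norm_def snd_diff)
  then have "(snd x - snd y)\<^sup>2 \<le> (norm (x - y))\<^sup>2"
    by (metis abs_ge_zero power2_abs power_mono)
  then show ?thesis
    using assms by (simp add: divide_right_mono)
qed

lemma borel_measurable_gaussian:
  fixes y :: "'m::finite point"
  shows "(\<lambda>x. exp (- ((norm (x - y))\<^sup>2 / (2 * T)))) \<in> borel_measurable lebesgue"
proof (rule measurable_completion)
  show "(\<lambda>x. exp (- ((norm (x - y))\<^sup>2 / (2 * T)))) \<in> borel_measurable lborel"
    by simp
qed

lemma set_integrable_gaussian:
  fixes y :: "'m::finite point"
  assumes "0 < T" "\<omega> \<in> sets lebesgue" "\<omega> \<subseteq> Omega L"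
  shows "set_integrable lebesgue \<omega> (\<lambda>x. exp (- ((norm (x - y))\<^sup>2 / (2 * T))))"
  unfolding set_integrable_def
proof (rule Bochner_Integration.integrable_bound)
  show "integrable lebesgue
      (\<lambda>x. indicator (Omega L) x * exp (- ((snd x - snd y)\<^sup>2 / (2 * T))))"
    using integrable_axial_gaussian[OF assms(1), where s = "snd y" and L = L]
    by (subst integrable_completion) auto
  show "(\<lambda>x. indicator \<omega> x *\<^sub>R exp (- ((norm (x - y))\<^sup>2 / (2 * T)))) \<in> borel_measurable lebesgue"
    by (intro borel_measurable_scaleR borel_measurable_gaussian borel_measurable_indicator assms(2))
  show "AE x in lebesgue. norm (indicator \<omega> x *\<^sub>R exp (- ((norm (x - y))\<^sup>2 / (2 * T))))
      \<le> norm (indicator (Omega L) x * exp (- ((snd x - snd y)\<^sup>2 / (2 * T))))"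
    using assms(3) exp_norm_le_exp_snd[OF assms(1), of _ y]
    by (intro AE_I2) (auto simp: indicator_def simp del: exp_le_cancel_iff split_paired_All)
qed

text \<open>
  Positivity matters because \<open>ln 0 = 0\<close>: only integrals tending to \<open>0\<close> through positive values make
  their logarithms diverge.
\<close>

lemma gaussian_integral_pos:
  fixes y :: "'m::finite point"
  assumes "0 < T" "\<omega> \<in> sets lebesgue" "\<omega> \<subseteq> Omega L" "emeasure lebesgue \<omega> > 0"
  shows "0 < (LINT x:\<omega>|lebesgue. exp (- ((norm (x - y))\<^sup>2 / (2 * T))))"
proof -
  let ?f = "\<lambda>x. indicator \<omega> x *\<^sub>R exp (- ((norm (x - y))\<^sup>2 / (2 * T)))"
  have int: "integrable lebesgue ?f"
    using set_integrable_gaussian[OF assms(1-3)] by (simp add: set_integrable_def)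
  have "\<not> (AE x in lebesgue. ?f x = 0)"
  proof
    assume "AE x in lebesgue. ?f x = 0"
    then have "AE x in lebesgue. x \<notin> \<omega>"
      by eventually_elim (auto simp: indicator_def split: if_splits)
    then have "emeasure lebesgue \<omega> = 0"
      using assms(2) by (subst (asm) AE_iff_measurable) auto
    then show False using assms(4) by simp
  qed
  then have "integral\<^sup>L lebesgue ?f \<noteq> 0"
    using int by (subst integral_nonneg_eq_0_iff_AE) auto
  moreover have "0 \<le> integral\<^sup>L lebesgue ?f"
    by simp
  ultimately show ?thesis
    unfolding set_lebesgue_integral_def by (simp only: less_le not_sym simp_thms)
qed

section \<open>Thickness and Gaussian integrals\<close>

text \<open>
  With \<open>V\<close> the volume of the boxes, \<open>\<delta> = exp (- (norm a)\<^sup>2 / (2 * T)) * (\<gamma> * V)\<close> works: all of a box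
  adherent to \<open>y\<close> is within distance \<open>norm a\<close> of \<open>y\<close>.
\<close>

lemma thick_imp_gaussian_integral_bounded_below:
  fixes \<omega> :: "'m::finite point set"
  assumes "thick L \<omega>" "0 < T"
  obtains \<delta> where "0 < \<delta>"
    "\<And>y. y \<in> Omega L \<Longrightarrow> \<delta> \<le> (LINT x:\<omega>|lebesgue. exp (- ((norm (x - y))\<^sup>2 / (2 * T))))"
proof -
  obtain \<gamma> and a :: "'m point" where \<omega>: "\<omega> \<in> sets lebesgue" "\<omega> \<subseteq> Omega L"
    and \<gamma>: "0 < \<gamma>" and a: "\<forall>j. 0 < fst a $ j \<and> fst a $ j \<le> 2 * pi * L" "0 < snd a"
    and th: "\<And>c. box c (c + a) \<subseteq> Omega L \<Longrightarrow>
      \<gamma> * measure lebesgue (box c (c + a)) \<le> measure lebesgue (\<omega> \<inter> box c (c + a))"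
    using assms(1) unfolding thick_def by blast
  define V where "V = (\<Prod>b\<in>Basis. a \<bullet> b)"
  have a_pos: "0 < a \<bullet> b" if "b \<in> Basis" for b
    using inner_Basis_pos_point that a by blast
  have V: "measure lebesgue (box c (c + a)) = V" for c
    unfolding V_def using a_pos by (rule measure_lebesgue_box_add)
  have "0 < V"
    unfolding V_def using a_pos by (intro prod_pos) auto
  let ?e = "exp (- ((norm a)\<^sup>2 / (2 * T)))"
  show ?thesis
  proof (rule that)
    show "0 < ?e * (\<gamma> * V)"
      using \<open>0 < V\<close> \<gamma> by simp
    fix y :: "'m point" assume "y \<in> Omega L"
    then obtain c where c: "box c (c + a) \<subseteq> Omega L" "y \<in> cbox c (c + a)"
      using closed_box_at_point_of_Omega a by metis
    let ?P = "box c (c + a)"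
    have near: "norm (x - y) \<le> norm a" if "x \<in> ?P" for x
    proof -
      have "dist x y \<le> diameter (cbox c (c + a))"
        using that c(2) box_subset_cbox by (intro diameter_bounded_bound) auto
      also have "\<dots> = norm a"
        using a_pos by (subst diameter_cbox) (auto simp: dist_norm inner_add_left less_imp_le)
      finally show ?thesis by (simp add: dist_norm)
    qed
    have fin: "\<omega> \<inter> ?P \<in> lmeasurable"
      using \<omega>(1) by (rule lmeasurable_Int_box)
    have "?e * (\<gamma> * V) \<le> ?e * measure lebesgue (\<omega> \<inter> ?P)"
      using th[OF c(1)] by (simp add: V)
    also have "\<dots> = (LINT x|lebesgue. ?e * indicator (\<omega> \<inter> ?P) x)"
      by simp
    also have "\<dots> \<le> (LINT x:\<omega>|lebesgue. exp (- ((norm (x - y))\<^sup>2 / (2 * T))))"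
      unfolding set_lebesgue_integral_def
    proof (rule integral_mono)
      show "integrable lebesgue (\<lambda>x. ?e * indicator (\<omega> \<inter> ?P) x)"
        using fin by (intro integrable_mult_right) (auto intro!: integrable_real_indicator simp: fmeasurable_def)
      show "integrable lebesgue (\<lambda>x. indicator \<omega> x *\<^sub>R exp (- ((norm (x - y))\<^sup>2 / (2 * T))))"
        using set_integrable_gaussian[OF assms(2) \<omega>] by (simp add: set_integrable_def)
      show "?e * indicator (\<omega> \<inter> ?P) x
          \<le> indicator \<omega> x *\<^sub>R exp (- ((norm (x - y))\<^sup>2 / (2 * T)))" for x
        using near[of x] assms(2)
        by (auto simp: indicator_def intro!: divide_right_mono power_mono)
    qed
    finally show "?e * (\<gamma> * V) \<le> (LINT x:\<omega>|lebesgue. exp (- ((norm (x - y))\<^sup>2 / (2 * T))))" .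
  qed
qed

text \<open>
  The set in the conclusion is the box of full width and length \<open>2 * h\<close> centred at height \<open>s\<close>.
  Thickness fails for every proportion, so the proportion can be chosen after the volume of the box;
  this converts low density into small mass.
\<close>

lemma not_thick_imp_long_sparse_box:
  fixes \<omega> :: "'m::finite point set"
  assumes "0 < L" "\<omega> \<in> sets lebesgue" "\<omega> \<subseteq> Omega L" "emeasure lebesgue \<omega> > 0"
    and nthick: "\<not> thick L \<omega>" and "0 < h" "0 < \<epsilon>"
  obtains s where
    "measure lebesgue (\<omega> \<inter> (box 0 (\<chi> j. 2 * pi * L) \<times> {s - h <..< s + h})) < \<epsilon>"
proof -
  let ?a = "((\<chi> j. 2 * pi * L), 2 * h) :: 'm point"
  define V where "V = (\<Prod>b\<in>Basis. ?a \<bullet> b)"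
  have a_pos: "0 < ?a \<bullet> b" if "b \<in> Basis" for b
    using assms that by (intro inner_Basis_pos_point) auto
  have V: "measure lebesgue (box c (c + ?a)) = V" for c
    unfolding V_def using a_pos by (rule measure_lebesgue_box_add)
  have "0 < V"
    unfolding V_def using a_pos by (intro prod_pos) auto
  \<comment> \<open>roughly \<open>\<epsilon> / V\<close>, with \<open>\<epsilon>\<close> added to the denominator to keep \<open>\<gamma> \<le> 1\<close>\<close>
  define \<gamma> where "\<gamma> = \<epsilon> / (\<epsilon> + V)"
  have \<gamma>: "0 < \<gamma>" "\<gamma> \<le> 1" "\<gamma> * V < \<epsilon>"
    using \<open>0 < V\<close> \<open>0 < \<epsilon>\<close> by (auto simp: \<gamma>_def field_simps)
  have "\<forall>j. 0 < fst ?a $ j \<and> fst ?a $ j \<le> 2 * pi * L" "0 < snd ?a"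
    using assms by auto
  then obtain c where c: "box c (c + ?a) \<subseteq> Omega L"
    "measure lebesgue (\<omega> \<inter> box c (c + ?a)) < \<gamma> * measure lebesgue (box c (c + ?a))"
    using nthick assms(2-4) \<gamma>(1,2) unfolding thick_def by (meson not_le)
  have "fst c = 0"
    using fst_corner_of_full_width_box[OF c(1)] assms by simp
  then have "box c (c + ?a) = box 0 (\<chi> j. 2 * pi * L) \<times> {(snd c + h) - h <..< (snd c + h) + h}"
    by (simp add: box_prod[of c] box_real algebra_simps)
  then show ?thesis
    using that[of "snd c + h"] c(2) \<gamma>(3) V by (metis less_trans)
qed

text \<open>
  Near \<open>y\<close> (in the last coordinate) the Gaussian is bounded by \<open>1\<close>, away from \<open>y\<close> by its axial
  factor, for which \<open>\<omega>\<close> may be enlarged to the slab.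
\<close>

lemma gaussian_integral_le_box_plus_tail:
  fixes \<omega> :: "'m::finite point set" and y :: "'m point"
  assumes "0 < T" "\<omega> \<in> sets lebesgue" "\<omega> \<subseteq> Omega L"
  shows "(LINT x:\<omega>|lebesgue. exp (- ((norm (x - y))\<^sup>2 / (2 * T))))
    \<le> measure lebesgue (\<omega> \<inter> (box 0 (\<chi> j. 2 * pi * L) \<times> {snd y - h <..< snd y + h}))
      + (LINT x::'m point|lborel. indicator (Omega L \<inter> {x. h \<le> \<bar>snd x - snd y\<bar>}) x
          * exp (- ((snd x - snd y)\<^sup>2 / (2 * T))))"
    (is "?I \<le> measure lebesgue (\<omega> \<inter> ?P) + integral\<^sup>L lborel ?f")
proof -
  have meas: "?f \<in> borel_measurable borel"
    by (rule borel_measurable_axial_tail)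
  have "integrable lborel ?f"
    by (rule Bochner_Integration.integrable_bound
        [OF integrable_axial_gaussian[OF assms(1), where s = "snd y" and L = L]])
      (use meas in \<open>auto simp: indicator_def\<close>)
  then have f: "integrable lebesgue ?f"
    using meas by (subst integrable_completion) auto
  have "?P = box (0, snd y - h) ((\<chi> j. 2 * pi * L), snd y + h)"
    by (simp add: box_prod box_real)
  then have "\<omega> \<inter> ?P \<in> lmeasurable"
    using lmeasurable_Int_box[OF assms(2)] by simp
  then have P: "integrable lebesgue (indicator (\<omega> \<inter> ?P) :: _ \<Rightarrow> real)"
    by (auto intro!: integrable_real_indicator simp: fmeasurable_def)
  have "?I \<le> (LINT x|lebesgue. indicator (\<omega> \<inter> ?P) x + ?f x)"
    unfolding set_lebesgue_integral_def
  proof (rule integral_mono)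
    show "integrable lebesgue (\<lambda>x. indicator \<omega> x *\<^sub>R exp (- ((norm (x - y))\<^sup>2 / (2 * T))))"
      using set_integrable_gaussian[OF assms] by (simp add: set_integrable_def)
    show "integrable lebesgue (\<lambda>x. indicator (\<omega> \<inter> ?P) x + ?f x)"
      using P f by (rule Bochner_Integration.integrable_add)
    fix x
    show "indicator \<omega> x *\<^sub>R exp (- ((norm (x - y))\<^sup>2 / (2 * T))) \<le> indicator (\<omega> \<inter> ?P) x + ?f x"
    proof (cases "x \<in> \<omega>")
      case True
      then have x: "x \<in> Omega L"
        using assms(3) by blast
      show ?thesis
      proof (cases "\<bar>snd x - snd y\<bar> < h")
        case True
        then have "x \<in> ?P"
          using x by (cases x) (auto simp: Omega_eq_Times)
        then show ?thesis
          using \<open>x \<in> \<omega>\<close> x True assms(1) by simp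
      next
        case False
        then show ?thesis
          using \<open>x \<in> \<omega>\<close> x exp_norm_le_exp_snd[OF assms(1), of x y]
          by (auto simp: indicator_def)
      qed
    qed simp
  qed
  also have "\<dots> = measure lebesgue (\<omega> \<inter> ?P) + integral\<^sup>L lebesgue ?f"
    using P f by (subst Bochner_Integration.integral_add) auto
  also have "integral\<^sup>L lebesgue ?f = integral\<^sup>L lborel ?f"
    using meas by (intro integral_completion) auto
  finally show ?thesis .
qed

text \<open>
  Sparse boxes of half-length \<open>n + 1\<close> carrying mass less than \<open>1 / (n + 1)\<close> make both parts of the
  preceding bound vanish in the limit.
\<close>

lemma not_thick_imp_gaussian_integral_tendsto_0:
  fixes \<omega> :: "'m::finite point set"
  assumes "0 < L" "\<omega> \<in> sets lebesgue" "\<omega> \<subseteq> Omega L" "emeasure lebesgue \<omega> > 0"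
    and "\<not> thick L \<omega>" and "0 < T"
  obtains y :: "nat \<Rightarrow> 'm point" where "\<And>n. fst (y n) = (\<chi> j. pi * L)"
    "(\<lambda>n. LINT x:\<omega>|lebesgue. exp (- ((norm (x - y n))\<^sup>2 / (2 * T)))) \<longlonglongrightarrow> 0"
proof -
  let ?P = "\<lambda>s h. box 0 (\<chi> j. 2 * pi * L) \<times> {s - h <..< s + h} :: 'm point set"
  have "\<exists>s. measure lebesgue (\<omega> \<inter> ?P s (real (Suc n))) < 1 / real (Suc n)" for n
    by (rule not_thick_imp_long_sparse_box[OF assms(1-5), of "real (Suc n)" "1 / real (Suc n)"])
      auto
  then obtain s where s: "\<And>n. measure lebesgue (\<omega> \<inter> ?P (s n) (real (Suc n))) < 1 / real (Suc n)"
    by metis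
  let ?y = "\<lambda>n. ((\<chi> j. pi * L), s n) :: 'm point"
  let ?I = "\<lambda>n. LINT x:\<omega>|lebesgue. exp (- ((norm (x - ?y n))\<^sup>2 / (2 * T)))"
  let ?tail = "\<lambda>n. LINT x::'m point|lborel.
    indicator (Omega L \<inter> {x. real (Suc n) \<le> \<bar>snd x - s n\<bar>}) x * exp (- ((snd x - s n)\<^sup>2 / (2 * T)))"
  have "filterlim (\<lambda>n. real (Suc n)) at_top sequentially"
    using filterlim_real_sequentially filterlim_Suc by (rule filterlim_compose)
  then have "?tail \<longlonglongrightarrow> 0"
    by (intro axial_tail_integral_tendsto_0 assms)
  then have "(\<lambda>n. 1 / real (Suc n) + ?tail n) \<longlonglongrightarrow> 0 + 0"
    by (intro tendsto_add lim_inverse_n'[THEN LIMSEQ_Suc])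
  then have upper: "(\<lambda>n. 1 / real (Suc n) + ?tail n) \<longlonglongrightarrow> 0"
    by simp
  have "?I n \<le> 1 / real (Suc n) + ?tail n" for n
    using gaussian_integral_le_box_plus_tail[OF assms(6,2,3), of "?y n" "real (Suc n)"]
      add_right_mono[OF less_imp_le[OF s[of n]], of "?tail n"]
    unfolding snd_conv by (rule order_trans)
  moreover have "0 \<le> ?I n" for n
    unfolding set_lebesgue_integral_def by simp
  ultimately have "?I \<longlonglongrightarrow> 0"
    by (intro tendsto_sandwich[OF _ _ tendsto_const upper]) auto
  then show ?thesis
    using that[of ?y] by simp
qed

theorem lemma13:
  fixes L :: real and \<omega> :: "('m::finite point) set"
  assumes "L > 0"
    and "\<omega> \<in> sets lebesgue" and "\<omega> \<subseteq> Omega L" and "emeasure lebesgue \<omega> > 0"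
  shows "\<not> thick L \<omega> \<longleftrightarrow>
    (\<exists>(y :: nat \<Rightarrow> 'm point) (T::real) (\<kappa>::real).
       (\<forall>n. y n \<in> Omega L) \<and> T > 0 \<and> \<kappa> > 1 \<and>
       filterlim
         (\<lambda>n. - 2 * T * ln (LINT x:\<omega>|lebesgue. exp (- ((norm (x - y n))\<^sup>2 / (2 * T))))
              - \<kappa> * (pi\<^sup>2 * (real DIM('m point))\<^sup>2 / 4) * (T / bdist L T (y n))\<^sup>2)
         at_top sequentially)"
proof
  assume "\<not> thick L \<omega>"
  \<comment> \<open>any \<open>T > 0\<close> and \<open>\<kappa> > 1\<close> would do; take \<open>T = 1\<close> and \<open>\<kappa> = 2\<close>\<close>
  let ?G = "\<lambda>y. LINT x:\<omega>|lebesgue. exp (- ((norm (x - y :: 'm point))\<^sup>2 / (2 * 1)))"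
  obtain y :: "nat \<Rightarrow> 'm point" where y: "\<And>n. fst (y n) = (\<chi> j. pi * L)"
    and lim: "(\<lambda>n. ?G (y n)) \<longlonglongrightarrow> 0"
    using not_thick_imp_gaussian_integral_tendsto_0[OF assms \<open>\<not> thick L \<omega>\<close> zero_less_one] by blast
  define m where "m = min (pi * L) (1 * pi\<^sup>2 * real DIM('m point) / 4)"
  have "0 < m"
    using assms(1) by (simp add: m_def)
  define K where "K = 2 * (pi\<^sup>2 * (real DIM('m point))\<^sup>2 / 4)"
  have penalty: "K * (1 / bdist L 1 (y n))\<^sup>2 \<le> K * (1 / m)\<^sup>2" for n
  proof -
    have "m \<le> bdist L 1 (y n)"
      using infdist_axis_frontier_Omega[OF assms(1) y[of n]] unfolding m_def bdist_def
      by (intro min.mono) auto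
    then show ?thesis
      using \<open>0 < m\<close> unfolding K_def
      by (intro mult_left_mono power_mono divide_left_mono) auto
  qed
  have "filterlim (\<lambda>n. ?G (y n)) (at_right 0) sequentially"
    using gaussian_integral_pos[OF zero_less_one assms(2-4)] lim
    by (intro tendsto_imp_filterlim_at_right always_eventually allI)
  then have "filterlim (\<lambda>n. ln (?G (y n))) at_bot sequentially"
    by (rule filterlim_compose[OF ln_at_0])
  then have "filterlim (\<lambda>n. 2 * ln (?G (y n))) at_bot sequentially"
    by (intro filterlim_tendsto_pos_mult_at_bot[OF tendsto_const]) auto
  then have "filterlim (\<lambda>n. - 2 * ln (?G (y n))) at_top sequentially"
    by (simp add: filterlim_uminus_at_top)
  then have "filterlim (\<lambda>n. - (K * (1 / m)\<^sup>2) + - 2 * ln (?G (y n))) at_top sequentially"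
    by (intro filterlim_tendsto_add_at_top[OF tendsto_const])
  then have "filterlim (\<lambda>n. - 2 * 1 * ln (?G (y n)) - K * (1 / bdist L 1 (y n))\<^sup>2)
      at_top sequentially"
    by (rule filterlim_at_top_mono) (use penalty in \<open>auto intro!: always_eventually\<close>)
  moreover have "y n \<in> Omega L" for n
    using y[of n] assms(1) by (cases "y n") (auto simp: Omega_def)
  ultimately show "\<exists>(y :: nat \<Rightarrow> 'm point) (T::real) (\<kappa>::real).
       (\<forall>n. y n \<in> Omega L) \<and> T > 0 \<and> \<kappa> > 1 \<and>
       filterlim
         (\<lambda>n. - 2 * T * ln (LINT x:\<omega>|lebesgue. exp (- ((norm (x - y n))\<^sup>2 / (2 * T))))
              - \<kappa> * (pi\<^sup>2 * (real DIM('m point))\<^sup>2 / 4) * (T / bdist L T (y n))\<^sup>2)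
         at_top sequentially"
    unfolding K_def by (intro exI[of _ y] exI[of _ "1::real"] exI[of _ "2::real"]) simp
next
  assume "\<exists>(y :: nat \<Rightarrow> 'm point) (T::real) (\<kappa>::real).
       (\<forall>n. y n \<in> Omega L) \<and> T > 0 \<and> \<kappa> > 1 \<and>
       filterlim
         (\<lambda>n. - 2 * T * ln (LINT x:\<omega>|lebesgue. exp (- ((norm (x - y n))\<^sup>2 / (2 * T))))
              - \<kappa> * (pi\<^sup>2 * (real DIM('m point))\<^sup>2 / 4) * (T / bdist L T (y n))\<^sup>2)
         at_top sequentially"
  then obtain y :: "nat \<Rightarrow> 'm point" and T \<kappa> :: real
    where y: "\<And>n. y n \<in> Omega L" and T: "0 < T" and \<kappa>: "1 < \<kappa>"
      and lim: "filterlim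
         (\<lambda>n. - 2 * T * ln (LINT x:\<omega>|lebesgue. exp (- ((norm (x - y n))\<^sup>2 / (2 * T))))
              - \<kappa> * (pi\<^sup>2 * (real DIM('m point))\<^sup>2 / 4) * (T / bdist L T (y n))\<^sup>2)
         at_top sequentially"
    by blast
  show "\<not> thick L \<omega>"
  proof
    assume "thick L \<omega>"
    then obtain \<delta> where \<delta>: "0 < \<delta>" "\<And>y. y \<in> Omega L \<Longrightarrow>
        \<delta> \<le> (LINT x:\<omega>|lebesgue. exp (- ((norm (x - y))\<^sup>2 / (2 * T))))"
      using thick_imp_gaussian_integral_bounded_below T by blast
    have "eventually (\<lambda>n. - 2 * T * ln \<delta> <
        - 2 * T * ln (LINT x:\<omega>|lebesgue. exp (- ((norm (x - y n))\<^sup>2 / (2 * T))))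
          - \<kappa> * (pi\<^sup>2 * (real DIM('m point))\<^sup>2 / 4) * (T / bdist L T (y n))\<^sup>2) sequentially"
      using lim unfolding filterlim_at_top_dense by blast
    then obtain n where n: "- 2 * T * ln \<delta> <
        - 2 * T * ln (LINT x:\<omega>|lebesgue. exp (- ((norm (x - y n))\<^sup>2 / (2 * T))))
          - \<kappa> * (pi\<^sup>2 * (real DIM('m point))\<^sup>2 / 4) * (T / bdist L T (y n))\<^sup>2"
      using eventually_happens by force
    have "ln \<delta> \<le> ln (LINT x:\<omega>|lebesgue. exp (- ((norm (x - y n))\<^sup>2 / (2 * T))))"
      using \<delta>(1) \<delta>(2)[OF y] by (intro ln_mono) auto
    then have "T * ln \<delta> \<le> T * ln (LINT x:\<omega>|lebesgue. exp (- ((norm (x - y n))\<^sup>2 / (2 * T))))"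
      using T by (intro mult_left_mono) auto
    moreover have "0 \<le> \<kappa> * (pi\<^sup>2 * (real DIM('m point))\<^sup>2 / 4) * (T / bdist L T (y n))\<^sup>2"
      using \<kappa> by (intro mult_nonneg_nonneg) auto
    ultimately show False
      using n by linarith
  qed
qed

end
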